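(* Let $G_6$ be the cycle graph $C_{15}$ with vertices labeled $a_0,a_1,\dots,a_4,b_0,\dots,b_4,c_0,\dots,c_4$ in cyclic order, and for $i=0,\dots,4$ let $t_i=\{a_i,b_i,c_i\}$, $T_5=\{t_0,\dots,t_4\}$. Let $S(G_6,T_5)$ be the set of $3^5$ graphs obtained from $G_6$ by adding, for each $i=0,\dots,4$, one edge joining two of the three vertices of $t_i$. Then $$\gamma_{T_5}(G_6):=\min_{X\in S(G_6,T_5)}\gamma(X)=1.$$
   Context: $\gamma(X)$ denotes the minimum genus of a graph $X$, the least $k$ such that $X$ embeds in the closed orientable surface of genus $k$. *)

theory Defs
  imports "HOL-Analysis.Analysis"
begin

text \<open>A finite simple graph is a pair of a vertex set and a set of two-element edges.\<close>

type_synonym 'a sgraph = "'a set \<times> 'a set set"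

text \<open>
  A drawing without crossings: vertices are sent to distinct points, each edge to a simple arc
  (an injective path) joining the images of its ends, and the interior of each arc avoids all
  vertices and all other arcs.  Every space used below is Hausdorff, so that injective paths
  are homeomorphic embeddings of the unit interval.
\<close>

definition embeds_in :: "'a sgraph \<Rightarrow> 'b topology \<Rightarrow> bool" where
  "embeds_in G Y \<longleftrightarrow>
    (\<exists>(p :: 'a \<Rightarrow> 'b) (g :: 'a set \<Rightarrow> real \<Rightarrow> 'b).
      inj_on p (fst G) \<and> p ` fst G \<subseteq> topspace Y \<and>
      (\<forall>e\<in>snd G. pathin Y (g e) \<and> inj_on (g e) {0..1} \<and>
          {g e 0, g e 1} = p ` e \<and> g e ` {0<..<1} \<inter> p ` fst G = {}) \<and>
      (\<forall>e\<in>snd G. \<forall>f\<in>snd G. e \<noteq> f \<longrightarrow> g e ` {0<..<1} \<inter> g f ` {0<..<1} = {}))"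

definition quotient_topology :: "'a topology \<Rightarrow> ('a \<Rightarrow> 'b) \<Rightarrow> 'b topology" where
  "quotient_topology X q =
     topology (\<lambda>U. U \<subseteq> q ` topspace X \<and> openin X {x \<in> topspace X. q x \<in> U})"

lemma openin_quotient_topology:
  "openin (quotient_topology X q) U \<longleftrightarrow>
     U \<subseteq> q ` topspace X \<and> openin X {x \<in> topspace X. q x \<in> U}"
proof -
  have "istopology (\<lambda>U. U \<subseteq> q ` topspace X \<and> openin X {x \<in> topspace X. q x \<in> U})"
    unfolding istopology_def
  proof (intro conjI allI impI)
    fix S T
    assume *: "S \<subseteq> q ` topspace X \<and> openin X {x \<in> topspace X. q x \<in> S}"
      "T \<subseteq> q ` topspace X \<and> openin X {x \<in> topspace X. q x \<in> T}"
    show "S \<inter> T \<subseteq> q ` topspace X" using * by blast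
    have "{x \<in> topspace X. q x \<in> S \<inter> T} = {x \<in> topspace X. q x \<in> S} \<inter> {x \<in> topspace X. q x \<in> T}"
      by blast
    then show "openin X {x \<in> topspace X. q x \<in> S \<inter> T}" using * by auto
  next
    fix K
    assume *: "\<forall>S\<in>K. S \<subseteq> q ` topspace X \<and> openin X {x \<in> topspace X. q x \<in> S}"
    show "\<Union>K \<subseteq> q ` topspace X" using * by blast
    have "{x \<in> topspace X. q x \<in> \<Union>K} = (\<Union>S\<in>K. {x \<in> topspace X. q x \<in> S})"
      by blast
    then show "openin X {x \<in> topspace X. q x \<in> \<Union>K}" using * by auto
  qed
  then show ?thesis
    by (simp add: quotient_topology_def topology_inverse')
qed

lemma topspace_quotient_topology: "topspace (quotient_topology X q) = q ` topspace X"
proof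
  show "topspace (quotient_topology X q) \<subseteq> q ` topspace X"
    using openin_topspace[of "quotient_topology X q"] unfolding openin_quotient_topology by blast
  have "{x \<in> topspace X. q x \<in> q ` topspace X} = topspace X" by blast
  then have "openin (quotient_topology X q) (q ` topspace X)"
    by (simp add: openin_quotient_topology)
  then show "q ` topspace X \<subseteq> topspace (quotient_topology X q)"
    by (rule openin_subset)
qed

lemma quotient_map_quotient_topology: "quotient_map X (quotient_topology X q) q"
  by (auto simp: quotient_map_def topspace_quotient_topology openin_quotient_topology)

text \<open>
  For \<open>k \<ge> 1\<close> the closed orientable surface of genus \<open>k\<close> is the regular \<open>4k\<close>-gon with its sides
  glued in pairs according to the word
  \<open>a\<^sub>1 b\<^sub>1 a\<^sub>1\<^sup>-\<^sup>1 b\<^sub>1\<^sup>-\<^sup>1 \<dots> a\<^sub>k b\<^sub>k a\<^sub>k\<^sup>-\<^sup>1 b\<^sub>k\<^sup>-\<^sup>1\<close>,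
  read around the boundary.  Points of the surface are the equivalence classes.
\<close>

definition corner :: "nat \<Rightarrow> nat \<Rightarrow> complex" where
  "corner k j = cis (2 * pi * real j / real (4 * k))"

definition polygon :: "nat \<Rightarrow> complex set" where
  "polygon k = convex hull (corner k ` {..<4 * k})"

inductive side_glued :: "nat \<Rightarrow> complex \<Rightarrow> complex \<Rightarrow> bool" for k where
  "\<lbrakk>m < k; t \<in> {0..1}\<rbrakk> \<Longrightarrow>
     side_glued k (linepath (corner k (4*m)) (corner k (4*m+1)) t)
                  (linepath (corner k (4*m+3)) (corner k (4*m+2)) t)"
| "\<lbrakk>m < k; t \<in> {0..1}\<rbrakk> \<Longrightarrow>
     side_glued k (linepath (corner k (4*m+1)) (corner k (4*m+2)) t)
                  (linepath (corner k (4*m+4)) (corner k (4*m+3)) t)"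

definition glued_polygon :: "nat \<Rightarrow> complex set topology" where
  "glued_polygon k =
     quotient_topology (top_of_set (polygon k)) (\<lambda>z. {w. equivclp (side_glued k) z w})"

definition embeds_in_genus :: "'a sgraph \<Rightarrow> nat \<Rightarrow> bool" where
  "embeds_in_genus G k \<longleftrightarrow>
     (if k = 0 then embeds_in G (top_of_set (sphere (0 :: real^3) 1))
      else embeds_in G (glued_polygon k))"

text \<open>On \<^typ>\<open>enat\<close> the infimum of a nonempty set is its least element.\<close>

definition genus :: "'a sgraph \<Rightarrow> enat" where
  "genus G = (INF k \<in> {k. embeds_in_genus G k}. enat k)"

definition S_graphs :: "'a sgraph \<Rightarrow> 'a set set \<Rightarrow> 'a sgraph set" where
  "S_graphs G T =
     {(fst G, snd G \<union> e ` T) | e. \<forall>t\<in>T. e t \<subseteq> t \<and> card (e t) = 2}"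

definition genus_T :: "'a set set \<Rightarrow> 'a sgraph \<Rightarrow> enat" where
  "genus_T T G = Min (genus ` S_graphs G T)"

definition va :: "nat \<Rightarrow> nat" where "va i = i"
definition vb :: "nat \<Rightarrow> nat" where "vb i = 5 + i"
definition vc :: "nat \<Rightarrow> nat" where "vc i = 10 + i"

definition cycle_graph :: "nat \<Rightarrow> nat sgraph" where
  "cycle_graph n = ({..<n}, {{j, (j + 1) mod n} | j. j < n})"

definition G6 :: "nat sgraph" where "G6 = cycle_graph 15"

definition T5 :: "nat set set" where "T5 = {{va i, vb i, vc i} | i. i \<le> 4}"

lemma card_S_graphs_G6_T5: "card (S_graphs G6 T5) = 3 ^ 5"
proof -
  define C where "C = (\<lambda>t :: nat set. {e. e \<subseteq> t \<and> card e = 2})"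
  define h where "h = (\<lambda>e. (fst G6, snd G6 \<union> e ` T5))"
  have T5: "T5 = (\<lambda>i. {i, 5 + i, 10 + i}) ` {..<5}"
    by (auto simp: T5_def va_def vb_def vc_def)
  have fin: "finite T5" by (simp add: T5)
  have "inj_on (\<lambda>i::nat. {i, 5 + i, 10 + i}) {..<5}"
  proof (rule inj_onI)
    fix i j :: nat assume ij: "i \<in> {..<5}" "j \<in> {..<5}" "{i, 5 + i, 10 + i} = {j, 5 + j, 10 + j}"
    then have "i \<in> {j, 5 + j, 10 + j}" by blast
    then show "i = j" using ij by auto
  qed
  then have c5: "card T5 = 5" by (simp add: T5 card_image)
  have c3: "card t = 3 \<and> finite t" if "t \<in> T5" for t
    using that by (auto simp: T5)
  have cC: "card (C t) = 3" if "t \<in> T5" for t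
    using c3[OF that] n_subsets[of t 2] by (simp add: C_def eval_nat_numeral)
  have mod5: "y mod 5 = i" if "i < 5" "y \<in> {i, 5 + i, 10 + i}" for y i :: nat
    using that by (elim insertE emptyE) presburger+
  have disj: "s = t" if st: "s \<in> T5" "t \<in> T5" "s \<inter> t \<noteq> {}" for s t
  proof -
    obtain i j where ij: "i < 5" "s = {i, 5 + i, 10 + i}" "j < 5" "t = {j, 5 + j, 10 + j}"
      using st(1,2) unfolding T5 by blast
    obtain x where x: "x \<in> s" "x \<in> t" using st(3) by blast
    have "x mod 5 = i" "x mod 5 = j" using x ij mod5 by blast+
    then show ?thesis using ij by simp
  qed
  have out: "x \<notin> snd G6" if tx: "t \<in> T5" "x \<in> C t" for t x
  proof
    assume "x \<in> snd G6"
    then obtain j where j: "j < 15" "x = {j, (j + 1) mod 15}"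
      by (auto simp: G6_def cycle_graph_def)
    obtain i where i: "i < 5" "t = {i, 5 + i, 10 + i}" using tx(1) by (auto simp: T5)
    have "x \<subseteq> t" using tx(2) by (simp add: C_def)
    then have "j mod 5 = i" "((j + 1) mod 15) mod 5 = i" using j(2) i mod5 by blast+
    moreover have "((j + 1) mod 15) mod 5 = (j + 1) mod 5" by (simp add: mod_mod_cancel)
    ultimately have "(j + 1) mod 5 = j mod 5" by simp
    then show False by presburger
  qed
  have eq: "S_graphs G6 T5 = h ` PiE T5 C"
  proof (intro equalityI subsetI)
    fix X assume "X \<in> S_graphs G6 T5"
    then obtain e where e: "X = h e" "\<forall>t\<in>T5. e t \<in> C t"
      by (auto simp: S_graphs_def h_def C_def)
    have "h e = h (restrict e T5)" by (simp add: h_def)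
    moreover have "restrict e T5 \<in> PiE T5 C" using e by auto
    ultimately show "X \<in> h ` PiE T5 C" using e by auto
  next
    fix X assume "X \<in> h ` PiE T5 C"
    then show "X \<in> S_graphs G6 T5"
      by (fastforce simp: S_graphs_def h_def C_def PiE_iff)
  qed
  have "inj_on h (PiE T5 C)"
  proof (rule inj_onI)
    fix e f assume e: "e \<in> PiE T5 C" and f: "f \<in> PiE T5 C" and "h e = h f"
    then have un: "snd G6 \<union> e ` T5 = snd G6 \<union> f ` T5" by (simp add: h_def)
    show "e = f"
    proof (rule PiE_ext[OF e f])
      fix t assume t: "t \<in> T5"
      have et: "e t \<in> C t" using e t by auto
      then obtain s where s: "s \<in> T5" "e t = f s" using un out[OF t et] t by blast
      have "f s \<in> C s" using f s by auto
      then have "e t \<subseteq> s \<inter> t" "e t \<noteq> {}" using et s by (auto simp: C_def)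
      then have "s = t" using disj s t by blast
      then show "e t = f t" using s by simp
    qed
  qed
  then have "card (S_graphs G6 T5) = card (PiE T5 C)" by (simp add: eq card_image)
  also have "\<dots> = (\<Prod>t\<in>T5. 3)" using fin cC by (simp add: card_PiE)
  also have "\<dots> = 3 ^ 5" by (simp add: c5)
  finally show ?thesis .
qed

end

theory Submission
  imports Defs
begin

text \<open>
  On the sphere, the Jordan curve theorem cuts the complement of the 15-cycle into two sides, and
  two chords whose ends interlace on the cycle cannot lie on the same side: projecting
  stereographically from a point of the other side puts both chords inside a plane Jordan curve,
  where the theta-curve theorem separates the ends of one chord by the other. So an embedding in
  the sphere 2-colours the crossing graph of the five chords, which always contains an odd cycle:
  chords of the same kind always cross, and of the three kinds \<open>ab\<close>, \<open>bc\<close>, \<open>ca\<close> each crosses the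
  cyclically next kind exactly when its index is the larger one.

  On the torus \<open>\<real>\<^sup>2/\<int>\<^sup>2\<close>, put vertex \<open>j\<close> at \<open>(j/5, j/15)\<close>. The cycle becomes a straight closed
  geodesic in direction \<open>(3, 1)\<close>, and the chords \<open>a\<^sub>i b\<^sub>i\<close> become vertical segments of length \<open>1/3\<close>.
\<close>

section \<open>Crossing chords of a Jordan curve on the sphere\<close>

text \<open>The chord \<open>c\<close> cuts the inside of the closed curve into the insides of
  \<open>c1\<close> with \<open>c\<close> and of \<open>c2\<close> with \<open>c\<close>. A
  connected \<open>Q\<close> off \<open>c\<close> stays in one of these halves, and the closure of a
  half misses the opposite arc except at \<open>a\<close> and \<open>b\<close>, so \<open>Q\<close>
  cannot come close to both \<open>u\<close> and \<open>v\<close>.\<close>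

lemma crossing_chords_inside:
  fixes c1 c2 c :: "real \<Rightarrow> complex"
  assumes c1: "arc c1" "pathstart c1 = a" "pathfinish c1 = b"
    and c2: "arc c2" "pathstart c2 = a" "pathfinish c2 = b"
    and c: "arc c" "pathstart c = a" "pathfinish c = b"
    and disj: "path_image c1 \<inter> path_image c2 = {a,b}"
      "path_image c1 \<inter> path_image c = {a,b}" "path_image c2 \<inter> path_image c = {a,b}"
    and ins: "path_image c \<inter> inside (path_image c1 \<union> path_image c2) \<noteq> {}"
    and Q: "connected Q" "Q \<subseteq> inside (path_image c1 \<union> path_image c2) - path_image c"
    and u: "u \<in> closure Q" "u \<in> path_image c1 - {a,b}"
    and v: "v \<in> closure Q" "v \<in> path_image c2 - {a,b}"
  shows False
proof -
  let ?I = "inside (path_image c1 \<union> path_image c2)"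
  let ?I1 = "inside (path_image c1 \<union> path_image c)"
  let ?I2 = "inside (path_image c2 \<union> path_image c)"
  have "a \<noteq> b" using c by (metis arc_distinct_ends)
  then obtain dis: "?I1 \<inter> ?I2 = {}" and un: "?I1 \<union> ?I2 \<union> (path_image c - {a,b}) = ?I"
    by (rule split_inside_simple_closed_curve[OF arc_imp_simple_path[OF c1(1)] c1(2,3)
          arc_imp_simple_path[OF c2(1)] c2(2,3) arc_imp_simple_path[OF c(1)] c(2,3) _ disj ins])
  have cl: "closed (path_image c1 \<union> path_image c)" "closed (path_image c2 \<union> path_image c)"
    using c1 c2 c by (simp_all add: closed_Un closed_arc_image)
  have "Q \<subseteq> ?I1 \<union> ?I2" using Q un by blast
  then have "?I1 \<inter> Q = {} \<or> ?I2 \<inter> Q = {}"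
    using connectedD[OF Q(1) open_inside[OF cl(1)] open_inside[OF cl(2)]] dis by blast
  then have "Q \<subseteq> ?I2 \<or> Q \<subseteq> ?I1" using \<open>Q \<subseteq> ?I1 \<union> ?I2\<close> by blast
  then have "u \<in> closure ?I2 \<or> v \<in> closure ?I1" using u v closure_mono by blast
  then have "u \<in> ?I2 \<union> (path_image c2 \<union> path_image c) \<or> v \<in> ?I1 \<union> (path_image c1 \<union> path_image c)"
    using closure_inside_subset[OF cl(1)] closure_inside_subset[OF cl(2)] by blast
  \<comment> \<open>\<open>u\<close> lies on \<open>c1\<close> away from its ends, hence off
    \<open>c2\<close> and \<open>c\<close>, so only the open half remains for it; likewise for
    \<open>v\<close>. Both halves are within the inside of the curve, which contains neither
    point.\<close>
  then have "u \<in> ?I \<or> v \<in> ?I" using u v disj un by blast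
  then show False using u v inside_no_overlap[of "path_image c1 \<union> path_image c2"] by blast
qed

section \<open>Stereographic projection and the Jordan curve theorem on the sphere\<close>

lemma sphere_minus_point_homeomorphism:
  fixes N :: "real^3"
  assumes "N \<in> sphere 0 1"
  obtains h :: "real^3 \<Rightarrow> complex" and k where "homeomorphism (sphere 0 1 - {N}) UNIV h k"
proof -
  have "sphere 0 1 - {N} homeomorphic (UNIV :: complex set)"
    using homeomorphic_punctured_affine_sphere_affine[of 1 N 0 UNIV "UNIV :: complex set"] assms
    by (simp add: affine_UNIV)
  then show ?thesis using that by (auto simp: homeomorphic_def)
qed

text \<open>\<open>N\<close> plays the role of infinity: the part of \<open>S\<close> outside a ball
  about \<open>N\<close> is compact, so its planar image is bounded and cannot contain
  \<open>U\<close>.\<close>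

lemma point_in_closure_of_unbounded_preimage:
  fixes N :: "'a :: metric_space"
  assumes hk: "homeomorphism (S - {N}) UNIV h k" and S: "compact S"
    and U: "\<not> bounded (U :: complex set)"
  shows "N \<in> closure (k ` U)"
proof (rule ccontr)
  assume "N \<notin> closure (k ` U)"
  then obtain e where e: "e > 0" "\<And>y. y \<in> k ` U \<Longrightarrow> e \<le> dist y N"
    unfolding closure_approachable by (meson not_le)
  let ?K = "S - ball N e"
  have "?K \<subseteq> S - {N}" using e by auto
  moreover have "compact ?K" using S by (simp add: compact_diff)
  ultimately have "compact (h ` ?K)"
    using hk by (meson compact_continuous_image continuous_on_subset homeomorphism_cont1)
  moreover have "U \<subseteq> h ` ?K"
  proof
    fix x assume "x \<in> U"
    have "k x \<in> S" "h (k x) = x" using hk by (auto simp: homeomorphism_def)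
    moreover have "k x \<notin> ball N e" using e(2)[of "k x"] \<open>x \<in> U\<close> by (auto simp: dist_commute)
    ultimately show "x \<in> h ` ?K" by (metis Diff_iff imageI)
  qed
  ultimately show False using U bounded_subset compact_imp_bounded by blast
qed

lemma arc_homeomorphism_image:
  assumes "arc c" "path_image c \<subseteq> S" "homeomorphism S T h k"
  shows "arc (h \<circ> c)"
  unfolding arc_def path_def
proof
  have "continuous_on (c ` {0..1}) h" "inj_on h (c ` {0..1})"
    using assms by (auto simp: path_image_def homeomorphism_def elim: continuous_on_subset
        intro: inj_on_inverseI[of _ k])
  then show "continuous_on {0..1} (h \<circ> c)" "inj_on (h \<circ> c) {0..1}"
    using assms(1) unfolding arc_def path_def by (blast intro: continuous_on_compose comp_inj_on)+
qed

text \<open>The planar Jordan theorem is pulled back along the projection from \<open>N\<close>; the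
  unbounded side regains \<open>N\<close> as its point at infinity. The maps \<open>h\<close> and
  \<open>k\<close> stay explicit so that a side can later be recognised as the planar inside or
  outside.\<close>

lemma Jordan_curve_punctured_sphere:
  fixes c1 c2 :: "real \<Rightarrow> real^3" and h :: "real^3 \<Rightarrow> complex"
  assumes c1: "arc c1" "pathstart c1 = a" "pathfinish c1 = b"
    and c2: "arc c2" "pathstart c2 = a" "pathfinish c2 = b"
    and disj: "path_image c1 \<inter> path_image c2 = {a,b}"
    and C: "C = path_image c1 \<union> path_image c2" "C \<subseteq> sphere 0 1"
    and N: "N \<in> sphere 0 1 - C"
    and hk: "homeomorphism (sphere 0 1 - {N}) UNIV h k"
    and I: "I = k ` inside (h ` C)" and O': "O' = insert N (k ` outside (h ` C))"
  shows "connected I" "connected O'" "I \<noteq> {}" "I \<union> O' = sphere 0 1 - C" "I \<inter> O' = {}"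
    "openin (top_of_set (sphere 0 1)) I" "openin (top_of_set (sphere 0 1)) O'"
proof -
  let ?S = "sphere 0 1 :: (real^3) set"
  have CS: "path_image c1 \<subseteq> ?S - {N}" "path_image c2 \<subseteq> ?S - {N}" "C \<subseteq> ?S - {N}"
    using C N by auto
  have kh: "k (h x) = x" if "x \<in> ?S" "x \<noteq> N" for x
    using hk that by (auto simp: homeomorphism_def)
  have hk': "h (k y) = y" and kS: "k y \<in> ?S - {N}" for y
    using hk by (simp add: homeomorphism_def) (use hk in \<open>metis homeomorphism_def UNIV_I imageI\<close>)
  have contk: "continuous_on UNIV k" using hk by (simp add: homeomorphism_def)
  have injh: "inj_on h (?S - {N})" using kh by (intro inj_on_inverseI[of _ k]) blast
  let ?c = "(h \<circ> c1) +++ reversepath (h \<circ> c2)"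
  have img: "path_image ?c = h ` C"
    using c1 c2 by (simp add: path_image_join path_image_compose C image_Un
        pathfinish_compose pathstart_compose)
  have "path_image (h \<circ> c1) \<inter> path_image (h \<circ> c2) = h ` {a,b}"
    using inj_on_image_Int[OF injh CS(1,2)] by (simp add: path_image_compose disj)
  moreover have "arc (h \<circ> c1)" "arc (h \<circ> c2)"
    using c1 c2 CS by (blast intro: arc_homeomorphism_image[OF _ _ hk])+
  ultimately have "simple_path ?c"
    using c1 c2
    by (intro simple_path_join_loop)
      (auto simp: pathfinish_compose pathstart_compose arc_reversepath)
  moreover have "pathfinish ?c = pathstart ?c"
    using c1 c2 by (simp add: pathfinish_compose pathstart_compose)
  ultimately have J: "inside (h ` C) \<noteq> {}" "open (inside (h ` C))" "connected (inside (h ` C))"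
      "open (outside (h ` C))" "connected (outside (h ` C))" "bounded (inside (h ` C))"
      "\<not> bounded (outside (h ` C))" "inside (h ` C) \<inter> outside (h ` C) = {}"
      "inside (h ` C) \<union> outside (h ` C) = - h ` C"
    using Jordan_inside_outside[of ?c] unfolding img by blast+
  show conI: "connected I" unfolding I
    by (rule connected_continuous_image[OF continuous_on_subset[OF contk] J(3)]) simp
  have conO: "connected (k ` outside (h ` C))"
    by (rule connected_continuous_image[OF continuous_on_subset[OF contk] J(5)]) simp
  \<comment> \<open>The outside is unbounded, so it accumulates at \<open>N\<close> and stays
    connected when \<open>N\<close> is added.\<close>
  have "N \<in> closure (k ` outside (h ` C))"
    by (rule point_in_closure_of_unbounded_preimage[OF hk _ J(7)]) simp
  then show "connected O'" unfolding O'
    using closure_subset[of "k ` outside (h ` C)"]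
    by (intro connected_intermediate_closure[OF conO]) auto
  show "I \<noteq> {}" using J by (simp add: I)
  show un: "I \<union> O' = ?S - C"
  proof
    show "I \<union> O' \<subseteq> ?S - C"
    proof
      fix x assume "x \<in> I \<union> O'"
      then consider "x = N" | y where "x = k y" "y \<notin> h ` C"
        using J(9) unfolding I O' by blast
      then show "x \<in> ?S - C"
        using N kS hk' by cases (simp, metis Diff_iff image_eqI)
    qed
    show "?S - C \<subseteq> I \<union> O'"
    proof
      fix x assume x: "x \<in> ?S - C"
      show "x \<in> I \<union> O'"
      proof (cases "x = N")
        case False
        then have "k (h x) = x" using kh x by blast
        moreover have "h x \<notin> h ` C"
          using inj_on_image_mem_iff[OF injh _ CS(3)] x False by blast
        then have "h x \<in> inside (h ` C) \<union> outside (h ` C)" using J(9) by blast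
        ultimately show ?thesis unfolding I O' by (metis UnE UnI1 UnI2 imageI insertCI)
      qed (simp add: O')
    qed
  qed
  show dis: "I \<inter> O' = {}"
  proof -
    have "k y \<noteq> N" "k y = k z \<longrightarrow> y = z" for y z using kS[of y] hk' by (auto, metis)
    then show ?thesis using J(8) unfolding I O' by blast
  qed
  have "openin (top_of_set (?S - {N})) I"
    unfolding I using J(2) homeomorphism_imp_open_map[OF homeomorphism_symD[OF hk]] by simp
  moreover have "openin (top_of_set ?S) (?S - {N})"
    by (simp add: openin_delete)
  ultimately show "openin (top_of_set ?S) I" by (rule openin_trans)
  \<comment> \<open>Openness of \<open>O'\<close> at \<open>N\<close> is not visible in the plane;
    it holds because \<open>O'\<close> is the complement in the sphere of the compact set
    \<open>I \<union> C\<close>.\<close>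
  have "compact (h ` C)"
    using compact_simple_path_image[OF \<open>simple_path ?c\<close>] img by simp
  have "compact (inside (h ` C) \<union> h ` C)"
    using J(6) \<open>compact (h ` C)\<close> closed_path_image_Un_inside[of ?c] \<open>simple_path ?c\<close>
    by (simp add: img Un_commute compact_eq_bounded_closed simple_path_imp_path)
  then have "compact (k ` (inside (h ` C) \<union> h ` C))"
    using contk compact_continuous_image continuous_on_subset by blast
  moreover have "k ` (inside (h ` C) \<union> h ` C) = I \<union> C"
  proof -
    have "k ` h ` C = C" using CS(3) kh by (force simp: image_image)
    then show ?thesis by (simp add: I image_Un)
  qed
  ultimately have "closed (I \<union> C)" by (simp add: compact_imp_closed)
  moreover have "O' = ?S - (I \<union> C)" using un dis by blast
  ultimately show "openin (top_of_set ?S) O'" 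
    by (metis Diff_eq open_Compl openin_open_Int)
qed

text \<open>The projection is hidden, and separation takes the form that no connected set off the
  curve meets both sides. Since \<open>N\<close> is placed in \<open>B\<close>, the nonempty
  \<open>A\<close> is the side opposite a prescribed point.\<close>

lemma Jordan_curve_sphere:
  fixes c1 c2 :: "real \<Rightarrow> real^3"
  assumes c1: "arc c1" "pathstart c1 = a" "pathfinish c1 = b"
    and c2: "arc c2" "pathstart c2 = a" "pathfinish c2 = b"
    and disj: "path_image c1 \<inter> path_image c2 = {a,b}"
    and C: "C = path_image c1 \<union> path_image c2" "C \<subseteq> sphere 0 1"
    and N: "N \<in> sphere 0 1 - C"
  obtains A B where "connected A" "connected B" "A \<union> B = sphere 0 1 - C" "N \<in> B" "A \<noteq> {}"
    "\<And>T. connected T \<Longrightarrow> T \<subseteq> sphere 0 1 - C \<Longrightarrow> T \<inter> A = {} \<or> T \<inter> B = {}"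
proof -
  obtain h :: "real^3 \<Rightarrow> complex" and k where hk: "homeomorphism (sphere 0 1 - {N}) UNIV h k"
    using N sphere_minus_point_homeomorphism by blast
  let ?A = "k ` inside (h ` C)" and ?B = "insert N (k ` outside (h ` C))"
  note J = Jordan_curve_punctured_sphere[OF c1 c2 disj C N hk refl refl]
  have "T \<inter> ?A = {} \<or> T \<inter> ?B = {}" if T: "connected T" "T \<subseteq> sphere 0 1 - C" for T
  proof -
    have "openin (top_of_set T) (T \<inter> X)" if "openin (top_of_set (sphere 0 1)) X" for X
      using that T(2) unfolding openin_open by blast
    then have o: "openin (top_of_set T) (T \<inter> ?A)" "openin (top_of_set T) (T \<inter> ?B)"
      using J(6,7) by blast+
    have "(T \<inter> ?A) \<union> (T \<inter> ?B) = T" "(T \<inter> ?A) \<inter> (T \<inter> ?B) = {}"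
      using J(4,5) T(2) by blast+
    then show ?thesis using T(1) o unfolding connected_openin_eq by metis
  qed
  then show ?thesis using that[of ?A ?B] J by blast
qed

text \<open>\<open>T\<close> records that \<open>c\<close> and \<open>Q\<close> lie on one side of
  the curve. The work consists in finding a projection centre on the other side and checking that
  everything then lands in the planar inside.\<close>

lemma crossing_chords_sphere:
  fixes c1 c2 c :: "real \<Rightarrow> real^3"
  assumes c1: "arc c1" "pathstart c1 = a" "pathfinish c1 = b"
    and c2: "arc c2" "pathstart c2 = a" "pathfinish c2 = b"
    and c: "arc c" "pathstart c = a" "pathfinish c = b" "path_image c \<subseteq> sphere 0 1"
    and disj: "path_image c1 \<inter> path_image c2 = {a,b}"
      "path_image c1 \<inter> path_image c = {a,b}" "path_image c2 \<inter> path_image c = {a,b}"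
    and C: "C = path_image c1 \<union> path_image c2" "C \<subseteq> sphere 0 1"
    and Q: "connected Q" "Q \<subseteq> sphere 0 1 - C - path_image c"
    and u: "u \<in> closure Q" "u \<in> path_image c1 - {a,b}"
    and v: "v \<in> closure Q" "v \<in> path_image c2 - {a,b}"
    and T: "connected T" "T \<subseteq> sphere 0 1 - C" "T \<inter> path_image c \<noteq> {}" "T \<inter> Q \<noteq> {}"
  shows False
proof -
  let ?S = "sphere 0 1 :: (real^3) set"
  \<comment> \<open>The Jordan theorem is first applied with a point \<open>N0\<close> of the chord,
    in order to find a point \<open>N\<close> on the opposite side; the projection is then taken
    from \<open>N\<close>.\<close>
  obtain N0 where N0: "N0 \<in> T" "N0 \<in> path_image c" using T by blast
  then have "N0 \<in> ?S - C" using T by blast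
  then obtain A B where AB: "A \<union> B = ?S - C" "N0 \<in> B" "A \<noteq> {}"
    and sep: "\<And>T. connected T \<Longrightarrow> T \<subseteq> ?S - C \<Longrightarrow> T \<inter> A = {} \<or> T \<inter> B = {}"
    using Jordan_curve_sphere[OF c1 c2 disj(1) C] by metis
  obtain N where N: "N \<in> A" using AB by blast
  define P where "P = path_image c - {a,b}"
  have "connected P"
    using connected_simple_path_endless[OF arc_imp_simple_path[OF c(1)]] c by (simp add: P_def)
  have PC: "P \<subseteq> ?S - C" using c(4) disj C by (auto simp: P_def)
  have N0P: "N0 \<in> P" using N0 \<open>N0 \<in> ?S - C\<close> disj C by (auto simp: P_def)
  \<comment> \<open>\<open>W\<close> joins the open chord, \<open>T\<close> and \<open>Q\<close>
    into one connected set, so all of it stays on the side of \<open>N0\<close>.\<close>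
  define W where "W = P \<union> T \<union> Q"
  have W: "connected W"
    unfolding W_def using \<open>connected P\<close> T Q N0 N0P by (intro connected_Un) auto
  have WC: "W \<subseteq> ?S - C" using PC T Q by (auto simp: W_def)
  then have WA: "W \<inter> A = {}" using sep[OF W WC] N0P AB by (auto simp: W_def)
  have NC: "N \<in> ?S - C" using N AB by blast
  obtain h :: "real^3 \<Rightarrow> complex" and k where hk: "homeomorphism (?S - {N}) UNIV h k"
    using NC sphere_minus_point_homeomorphism by blast
  note J = Jordan_curve_punctured_sphere[OF c1 c2 disj(1) C NC hk refl refl]
  have kh: "k (h x) = x" if "x \<in> ?S" "x \<noteq> N" for x
    using hk that by (auto simp: homeomorphism_def)
  have injh: "inj_on h (?S - {N})" using kh by (intro inj_on_inverseI[of _ k]) blast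
  have WN: "N \<notin> W" using WA N by blast
  have WI: "h x \<in> inside (h ` C)" if x: "x \<in> W" for x
  proof -
    \<comment> \<open>If \<open>W\<close> met the side of \<open>N\<close>, the union of the two
      would be a connected set off the curve containing \<open>N0\<close> from \<open>B\<close> and
      \<open>N\<close> from \<open>A\<close>.\<close>
    have "W \<inter> insert N (k ` outside (h ` C)) = {}"
    proof (rule ccontr)
      assume "W \<inter> insert N (k ` outside (h ` C)) \<noteq> {}"
      then have "connected (W \<union> insert N (k ` outside (h ` C)))"
        by (rule connected_Un[OF W J(2)])
      moreover have "W \<union> insert N (k ` outside (h ` C)) \<subseteq> ?S - C" using WC J(4) by blast
      moreover have "N0 \<in> W" using N0P by (simp add: W_def)
      ultimately show False using sep AB(2) N by blast
    qed
    then have "x \<in> k ` inside (h ` C)" using J(4) x WC by blast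
    then show ?thesis using hk by (auto simp: homeomorphism_def)
  qed
  have sub: "path_image c1 \<subseteq> ?S - {N}" "path_image c2 \<subseteq> ?S - {N}" "path_image c \<subseteq> ?S - {N}"
      "Q \<subseteq> ?S - {N}"
  proof -
    show "path_image c1 \<subseteq> ?S - {N}" "path_image c2 \<subseteq> ?S - {N}" using C NC by blast+
    have "{a,b} \<subseteq> C" using disj C by blast
    then show "path_image c \<subseteq> ?S - {N}" using c(4) WN NC unfolding W_def P_def by blast
    show "Q \<subseteq> ?S - {N}" using Q WN unfolding W_def by blast
  qed
  have hC: "h ` C = path_image (h \<circ> c1) \<union> path_image (h \<circ> c2)"
    by (simp add: C path_image_compose image_Un)
  have ends: "pathstart (h \<circ> g) = h (pathstart g)" "pathfinish (h \<circ> g) = h (pathfinish g)"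
    for g :: "real \<Rightarrow> real^3" by (simp_all add: pathstart_compose pathfinish_compose)
  have conth: "continuous_on (?S - {N}) h" using hk by (simp add: homeomorphism_def)
  have clo: "h x \<in> closure (h ` Q)" if x: "x \<in> closure Q" "x \<in> ?S - {N}" for x
  proof -
    obtain f where f: "\<And>n. f n \<in> Q" "f \<longlonglongrightarrow> x"
      using x(1) unfolding closure_sequential by blast
    then have "(h \<circ> f) \<longlonglongrightarrow> h x"
      using conth x(2) sub(4) unfolding continuous_on_sequentially by blast
    then show ?thesis using f(1) unfolding closure_sequential by (metis comp_apply imageI)
  qed
  show False
  proof (rule crossing_chords_inside)
    show "arc (h \<circ> c1)" "arc (h \<circ> c2)" "arc (h \<circ> c)"
      using c1 c2 c sub by (auto intro: arc_homeomorphism_image[OF _ _ hk])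
    show "pathstart (h \<circ> c1) = h a" "pathfinish (h \<circ> c1) = h b"
      "pathstart (h \<circ> c2) = h a" "pathfinish (h \<circ> c2) = h b"
      "pathstart (h \<circ> c) = h a" "pathfinish (h \<circ> c) = h b"
      using c1 c2 c by (simp_all add: ends)
    show "path_image (h \<circ> c1) \<inter> path_image (h \<circ> c2) = {h a, h b}"
      "path_image (h \<circ> c1) \<inter> path_image (h \<circ> c) = {h a, h b}"
      "path_image (h \<circ> c2) \<inter> path_image (h \<circ> c) = {h a, h b}"
      using inj_on_image_Int[OF injh sub(1,2)] inj_on_image_Int[OF injh sub(1,3)]
        inj_on_image_Int[OF injh sub(2,3)] by (simp_all add: path_image_compose disj)
    show "path_image (h \<circ> c) \<inter> inside (path_image (h \<circ> c1) \<union> path_image (h \<circ> c2)) \<noteq> {}"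
      using WI[of N0] N0P unfolding hC[symmetric] by (auto simp: W_def P_def path_image_compose)
    show "connected (h ` Q)"
      using Q(1) continuous_on_subset[OF conth sub(4)] by (rule connected_continuous_image[rotated])
    have "h ` Q \<inter> h ` path_image c = {}"
      using inj_on_image_Int[OF injh sub(4,3)] Q by auto
    then show "h ` Q \<subseteq> inside (path_image (h \<circ> c1) \<union> path_image (h \<circ> c2)) - path_image (h \<circ> c)"
      using WI unfolding hC[symmetric] by (auto simp: W_def path_image_compose)
    have ab: "a \<in> ?S - {N}" "b \<in> ?S - {N}" using disj sub by auto
    have ne: "h x \<in> path_image (h \<circ> g) - {h a, h b}"
      if "x \<in> path_image g - {a, b}" "path_image g \<subseteq> ?S - {N}" for x g
    proof -
      have "x \<in> ?S - {N}" "x \<in> path_image g" "x \<noteq> a" "x \<noteq> b" using that by blast+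
      then show ?thesis using inj_on_eq_iff[OF injh] ab by (simp add: path_image_compose)
    qed
    have "u \<in> ?S - {N}" "v \<in> ?S - {N}" using u(2) v(2) sub(1,2) by blast+
    then show "h u \<in> closure (h ` Q)" "h v \<in> closure (h ` Q)"
      using clo[OF u(1)] clo[OF v(1)] by simp_all
    show "h u \<in> path_image (h \<circ> c1) - {h a, h b}" by (rule ne[OF u(2) sub(1)])
    show "h v \<in> path_image (h \<circ> c2) - {h a, h b}" by (rule ne[OF v(2) sub(2)])
  qed
qed

section \<open>Residues, open arcs and orientation of arcs\<close>

lemma nat_mod_eq_imp_eq:
  fixes i j n :: nat
  assumes "i mod n = j mod n" "i \<le> j" "j < i + n"
  shows "i = j"
proof -
  have "n dvd j - i" using assms mod_eq_dvd_iff_nat[of i j n] by simp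
  moreover have "j - i < n" using assms by linarith
  ultimately have "j - i = 0" using dvd_imp_le not_le by blast
  then show ?thesis using assms by simp
qed

lemma path_image_eq_open_arc:
  "path_image g = g ` {0<..<1} \<union> {pathstart g, pathfinish g}"
proof -
  have "{0..1} = {0<..<1} \<union> {0, 1 :: real}" by auto
  then show ?thesis unfolding path_image_def pathstart_def pathfinish_def by auto
qed

lemma connected_open_arc: "path g \<Longrightarrow> connected (g ` {0<..<1})"
  unfolding path_def by (rule connected_continuous_image) (auto elim: continuous_on_subset)

lemma path_image_subset_closure_open_arc:
  assumes "path g"
  shows "path_image g \<subseteq> closure (g ` {0<..<1})"
proof -
  have "closure {0<..<1} = {0..1::real}" by simp
  then show ?thesis
    using image_closure_subset[of "{0<..<1}" g "closure (g ` {0<..<1})"] assms closure_subset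
    unfolding path_def path_image_def by force
qed

text \<open>A drawing prescribes the ends of an edge's arc only as an unordered pair; reversing the
  arc if necessary fixes its direction.\<close>

lemma arc_oriented:
  assumes "arc g" "{g 0, g 1} = {a, b}"
  obtains P where "arc P" "pathstart P = a" "pathfinish P = b"
    "P ` {0<..<1} = g ` {0<..<1}" "path_image P = path_image g"
proof (cases "g 0 = a")
  case True
  then have "g 1 = b" using assms by (metis doubleton_eq_iff)
  then show ?thesis using that[of g] assms True by (simp add: pathstart_def pathfinish_def)
next
  case False
  then have "g 0 = b" "g 1 = a" using assms by (metis doubleton_eq_iff)+
  moreover have "reversepath g ` {0<..<1} = g ` {0<..<1}"
  proof -
    have "(\<lambda>x. 1 - x) ` {0<..<1} = {0<..<1::real}"
      by (force simp: image_iff intro: bexI[of _ "1 - x" for x])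
    then show ?thesis unfolding reversepath_def by (metis image_image)
  qed
  ultimately show ?thesis
    using that[of "reversepath g"] arc_reversepath[OF assms(1)]
    by (simp add: pathstart_def pathfinish_def path_image_reversepath) (simp add: reversepath_def)
qed

section \<open>Cycles drawn on the sphere\<close>

text \<open>Vertices and edges are indexed by all natural numbers and read modulo \<open>n\<close>,
  so a segment may run past the index \<open>n\<close> without a case distinction. Periodicity is
  asked of images only, since arcs for congruent indices may be parametrised differently.\<close>

locale cycle_on_sphere =
  fixes n :: nat and V :: "nat \<Rightarrow> real^3" and G :: "nat \<Rightarrow> real \<Rightarrow> real^3"
  assumes V_eq_iff: "V k = V l \<longleftrightarrow> k mod n = l mod n"
    and arc_G: "arc (G k)" and start_G: "pathstart (G k) = V k"
    and finish_G: "pathfinish (G k) = V (Suc k)"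
    and G_sphere: "path_image (G k) \<subseteq> sphere 0 1"
    and G_periodic: "path_image (G (k mod n)) = path_image (G k)"
    and G_Int: "k mod n \<noteq> l mod n \<Longrightarrow>
      path_image (G k) \<inter> path_image (G l) \<subseteq> {V k, V (Suc k)} \<inter> {V l, V (Suc l)}"
begin

definition curve :: "(real^3) set" where "curve = (\<Union>k<n. path_image (G k))"

lemma curve_sphere: "curve \<subseteq> sphere 0 1"
  using G_sphere unfolding curve_def by blast

lemma V_in_G: "V k \<in> path_image (G k)" "V (Suc k) \<in> path_image (G k)"
  using start_G finish_G pathstart_in_path_image pathfinish_in_path_image by metis+

lemma segment_arc:
  assumes "0 < m" "m < n"
  shows "\<exists>c. arc c \<and> pathstart c = V x \<and> pathfinish c = V (x + m) \<and>
             path_image c = (\<Union>k\<in>{x..<x + m}. path_image (G k))"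
  using assms
proof (induction m)
  case (Suc m)
  show ?case
  proof (cases "m = 0")
    case True
    have "{x..<x + Suc 0} = {x}" by auto
    then show ?thesis using True arc_G start_G finish_G by (intro exI[of _ "G x"]) auto
  next
    case False
    then obtain c where c: "arc c" "pathstart c = V x" "pathfinish c = V (x + m)"
      "path_image c = (\<Union>k\<in>{x..<x + m}. path_image (G k))"
      using Suc by auto
    have "path_image c \<inter> path_image (G (x + m)) \<subseteq> {V (x + m)}"
    proof
      fix z assume z: "z \<in> path_image c \<inter> path_image (G (x + m))"
      then obtain k where k: "x \<le> k" "k < x + m" "z \<in> path_image (G k)" using c by auto
      have ne: "k mod n \<noteq> (x + m) mod n"
        using nat_mod_eq_imp_eq[of k n "x + m"] k Suc.prems by auto
      \<comment> \<open>\<open>Suc m < n\<close> keeps the new end vertex different from all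
        vertices already passed, so the two arcs share only the vertex where they are
        joined.\<close>
      have "V k \<noteq> V (Suc (x + m))" "V (Suc k) \<noteq> V (Suc (x + m))"
        using nat_mod_eq_imp_eq[of k n "Suc (x + m)"]
          nat_mod_eq_imp_eq[of "Suc k" n "Suc (x + m)"] k Suc.prems unfolding V_eq_iff by auto
      then show "z \<in> {V (x + m)}" using G_Int[OF ne] z k by auto
    qed
    then have "arc (c +++ G (x + m))"
      using c arc_G start_G by (intro arc_join) auto
    moreover have "{x..<x + Suc m} = insert (x + m) {x..<x + m}" by auto
    ultimately show ?thesis using c start_G finish_G
      by (intro exI[of _ "c +++ G (x + m)"]) (auto simp: path_image_join)
  qed
qed simp

text \<open>The index ranges \<open>x..<y\<close> and \<open>y..<x + n\<close> together run once
  round the cycle; the second arc is reversed at the end so that both lead from \<open>V x\<close>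
  to \<open>V y\<close>.\<close>

lemma curve_split:
  assumes "x < y" "y < n"
  obtains c1 c2 where "arc c1" "pathstart c1 = V x" "pathfinish c1 = V y"
    "arc c2" "pathstart c2 = V x" "pathfinish c2 = V y"
    "path_image c1 \<inter> path_image c2 = {V x, V y}" "curve = path_image c1 \<union> path_image c2"
    "\<forall>u. x < u \<and> u < y \<longrightarrow> V u \<in> path_image c1 - {V x, V y}"
    "\<forall>v<n. v < x \<or> y < v \<longrightarrow> V v \<in> path_image c2 - {V x, V y}"
proof -
  obtain c1 where c1: "arc c1" "pathstart c1 = V x" "pathfinish c1 = V y"
      "path_image c1 = (\<Union>k\<in>{x..<y}. path_image (G k))"
    using segment_arc[of "y - x" x] assms less_imp_diff_less[of y n x] by auto
  have Vxn: "V (x + n) = V x" by (simp add: V_eq_iff)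
  have "x + n - y < n" using assms by linarith
  then obtain c2 where c2: "arc c2" "pathstart c2 = V y" "pathfinish c2 = V x"
      "path_image c2 = (\<Union>k\<in>{y..<x + n}. path_image (G k))"
    using segment_arc[of "x + n - y" y] assms Vxn by auto
  have "path_image c1 \<inter> path_image c2 = {V x, V y}"
  proof
    show "{V x, V y} \<subseteq> path_image c1 \<inter> path_image c2"
      using c1 c2 by (metis Int_iff empty_subsetI insert_subset pathfinish_in_path_image
          pathstart_in_path_image)
    show "path_image c1 \<inter> path_image c2 \<subseteq> {V x, V y}"
    proof
      fix z assume "z \<in> path_image c1 \<inter> path_image c2"
      then obtain k l where kl: "x \<le> k" "k < y" "y \<le> l" "l < x + n"
        "z \<in> path_image (G k)" "z \<in> path_image (G l)" using c1 c2 by auto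
      have "k mod n \<noteq> l mod n" using nat_mod_eq_imp_eq[of k n l] kl by auto
      then have zkl: "z \<in> {V k, V (Suc k)} \<inter> {V l, V (Suc l)}" using G_Int kl by blast
      \<comment> \<open>A common point is a vertex with an index \<open>i\<close> on the first
        segment and a congruent index \<open>j\<close> on the second. As
        \<open>i \<le> y \<le> j \<le> x + n\<close>, either \<open>i = j = y\<close>, or
        \<open>j = i + n\<close> and then \<open>i = x\<close>.\<close>
      then obtain i j where ij: "z = V i" "V i = V j" "x \<le> i" "i \<le> y" "y \<le> j" "j \<le> x + n"
      proof -
        assume a: "\<And>i j. z = V i \<Longrightarrow> V i = V j \<Longrightarrow> x \<le> i \<Longrightarrow> i \<le> y \<Longrightarrow> y \<le> j \<Longrightarrow> j \<le> x + n \<Longrightarrow> thesis"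
        obtain i where i: "i = k \<or> i = Suc k" "z = V i" using zkl by blast
        obtain j where j: "j = l \<or> j = Suc l" "z = V j" using zkl by blast
        show thesis by (rule a[of i j]) (use i j kl in auto)
      qed
      show "z \<in> {V x, V y}"
      proof (cases "j < i + n")
        case True
        then have "i = j" using nat_mod_eq_imp_eq[of i n j] ij by (simp add: V_eq_iff)
        then show ?thesis using ij by auto
      next
        case False
        then have "i = x" using ij by auto
        then show ?thesis using ij by auto
      qed
    qed
  qed
  moreover have "curve = path_image c1 \<union> path_image c2"
  proof
    show "path_image c1 \<union> path_image c2 \<subseteq> curve"
    proof
      fix z assume "z \<in> path_image c1 \<union> path_image c2"
      then obtain k where "z \<in> path_image (G k)" using c1 c2 by auto
      moreover have "k mod n < n" using assms by simp
      ultimately show "z \<in> curve" unfolding curve_def using G_periodic by blast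
    qed
    show "curve \<subseteq> path_image c1 \<union> path_image c2"
    proof
      fix z assume "z \<in> curve"
      then obtain k where k: "k < n" "z \<in> path_image (G k)" unfolding curve_def by blast
      moreover have "path_image (G (k + n)) = path_image (G k)"
        using G_periodic[of k] G_periodic[of "k + n"] by simp
      \<comment> \<open>Indices below \<open>x\<close> occur on the second segment after a shift by
        \<open>n\<close>.\<close>
      moreover have "k \<in> {x..<y} \<or> k \<in> {y..<x + n} \<or> k + n \<in> {y..<x + n}"
        using assms k by auto
      ultimately show "z \<in> path_image c1 \<union> path_image c2" unfolding c1 c2 by blast
    qed
  qed
  moreover have "V u \<in> path_image c1 - {V x, V y}" if "x < u" "u < y" for u
  proof -
    have "V u \<in> path_image c1" using V_in_G(1)[of u] that unfolding c1 by auto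
    then show ?thesis using that assms by (auto simp: V_eq_iff)
  qed
  moreover have "V v \<in> path_image c2 - {V x, V y}" if v: "v < n" "v < x \<or> y < v" for v
  proof -
    obtain w where w: "y \<le> w" "w < x + n" "V w = V v"
      using v assms by (cases "y < v") (auto simp: V_eq_iff intro: that[of v] that[of "v + n"])
    then have "V v \<in> path_image c2" using V_in_G(1)[of w] unfolding c2 by auto
    then show ?thesis using v assms by (auto simp: V_eq_iff)
  qed
  ultimately show ?thesis
    using that[of c1 "reversepath c2"] c1(1-3) c2(1-3)
    by (simp add: arc_reversepath path_image_reversepath)
qed

text \<open>Cutting the cycle at the ends of \<open>P\<close> puts the interlacing vertices
  \<open>V u\<close> and \<open>V v\<close> on different pieces, while both are in the closure of
  the open arc of \<open>Q\<close>. \<open>T\<close> again expresses that the chords share a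
  side.\<close>

lemma crossing_chords_separated:
  assumes xy: "x < u" "u < y" "y < v" "v < n"
    and P: "arc P" "pathstart P = V x" "pathfinish P = V y"
      "path_image P \<subseteq> sphere 0 1" "P ` {0<..<1} \<inter> curve = {}"
    and Q: "arc Q" "pathstart Q = V u" "pathfinish Q = V v"
      "path_image Q \<subseteq> sphere 0 1" "Q ` {0<..<1} \<inter> curve = {}"
    and PQ: "P ` {0<..<1} \<inter> Q ` {0<..<1} = {}"
    and T: "connected T" "T \<subseteq> sphere 0 1 - curve"
      "T \<inter> P ` {0<..<1} \<noteq> {}" "T \<inter> Q ` {0<..<1} \<noteq> {}"
  shows False
proof -
  obtain c1 c2 where c1: "arc c1" "pathstart c1 = V x" "pathfinish c1 = V y"
    and c2: "arc c2" "pathstart c2 = V x" "pathfinish c2 = V y"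
    and c12: "path_image c1 \<inter> path_image c2 = {V x, V y}" "curve = path_image c1 \<union> path_image c2"
    and u: "\<forall>u. x < u \<and> u < y \<longrightarrow> V u \<in> path_image c1 - {V x, V y}"
    and v: "\<forall>v<n. v < x \<or> y < v \<longrightarrow> V v \<in> path_image c2 - {V x, V y}"
    by (rule curve_split[OF less_trans[OF xy(1,2)] less_trans[OF xy(3,4)]])
  have P': "path_image P = P ` {0<..<1} \<union> {V x, V y}"
    and Q': "path_image Q = Q ` {0<..<1} \<union> {V u, V v}"
    using P Q path_image_eq_open_arc by metis+
  have xyV: "{V x, V y} \<subseteq> path_image c1" "{V x, V y} \<subseteq> path_image c2" using c12 by blast+
  show False
  proof (rule crossing_chords_sphere[OF c1 c2 P(1-4) c12(1) _ _ c12(2) curve_sphere])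
    show "path_image c1 \<inter> path_image P = {V x, V y}" "path_image c2 \<inter> path_image P = {V x, V y}"
      using P(5) xyV unfolding P' c12(2) by blast+
    show "connected (Q ` {0<..<1})" using Q(1) connected_open_arc arc_imp_path by blast
    show "Q ` {0<..<1} \<subseteq> sphere 0 1 - curve - path_image P"
    proof -
      have "V x \<in> curve" "V y \<in> curve" using xyV c12(2) by blast+
      then show ?thesis using Q(4,5) PQ unfolding P' Q' by blast
    qed
    show "V u \<in> closure (Q ` {0<..<1})" "V v \<in> closure (Q ` {0<..<1})"
      using path_image_subset_closure_open_arc[of Q] Q(1) arc_imp_path unfolding Q' by blast+
    show "V u \<in> path_image c1 - {V x, V y}" "V v \<in> path_image c2 - {V x, V y}"
      using u v xy by simp_all
    show "connected T" "T \<subseteq> sphere 0 1 - curve" by (fact T)+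
    show "T \<inter> path_image P \<noteq> {}" "T \<inter> Q ` {0<..<1} \<noteq> {}" using T unfolding P' by blast+
  qed
qed

end

section \<open>Two-colouring the five chords: no drawing on the sphere\<close>

lemma chords_conflict_not_2_colourable:
  fixes x y :: "nat \<Rightarrow> nat" and col :: "nat \<Rightarrow> bool"
  assumes "\<And>i. i < 5 \<Longrightarrow> (x i, y i) \<in> {(i, 5 + i), (5 + i, 10 + i), (i, 10 + i)}"
    and "\<And>i j. i < 5 \<Longrightarrow> j < 5 \<Longrightarrow> x i < x j \<Longrightarrow> x j < y i \<Longrightarrow> y i < y j \<Longrightarrow> col i \<noteq> col j"
  shows False
proof -
  define A where "A i \<longleftrightarrow> x i = i \<and> y i = 5 + i" for i
  define B where "B i \<longleftrightarrow> x i = 5 + i \<and> y i = 10 + i" for i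
  define C where "C i \<longleftrightarrow> x i = i \<and> y i = 10 + i" for i
  have ty: "A i \<or> B i \<or> C i" if "i < 5" for i
    using assms(1)[OF that] by (auto simp: A_def B_def C_def)
  \<comment> \<open>These are the crossing pairs for \<open>i < j\<close>. The chord with the
    smaller first end may be either of the two, hence both orders of the assumption.\<close>
  have c: "(A i \<and> A j \<or> B i \<and> B j \<or> C i \<and> C j \<or> B i \<and> A j \<or> C i \<and> B j \<or> A i \<and> C j)
      \<longrightarrow> (col i \<longleftrightarrow> \<not> col j)" if "i < j" "j < 5" for i j
    using that assms(2)[of i j] assms(2)[of j i] by (auto simp: A_def B_def C_def)
  \<comment> \<open>Three chords of one kind form a triangle of crossings. Otherwise the kinds occur
    twice, twice and once; up to cyclic renaming the single one is \<open>C\<close>, and avoiding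
    triangles forces the kinds \<open>A\<close>, \<open>B\<close>, \<open>C\<close>,
    \<open>A\<close>, \<open>B\<close> in order of index, whose crossings form a 5-cycle. The
    propositional check covers all choices.\<close>
  show False
    using ty[of 0] ty[of 1] ty[of 2] ty[of 3] ty[of 4] c[of 0 1] c[of 0 2] c[of 0 3] c[of 0 4]
      c[of 1 2] c[of 1 3] c[of 1 4] c[of 2 3] c[of 2 4] c[of 3 4]
    by simp sat
qed

text \<open>A drawing makes the 15-cycle an instance of \<open>cycle_on_sphere\<close>; the side
  containing the midpoint of a chord serves as its colour.\<close>

lemma S_graphs_G6_T5_not_spherical:
  assumes X: "X \<in> S_graphs G6 T5"
  shows "\<not> embeds_in X (top_of_set (sphere (0 :: real^3) 1))"
proof
  let ?S = "sphere (0 :: real^3) 1"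
  assume "embeds_in X (top_of_set ?S)"
  obtain e where e: "X = (fst G6, snd G6 \<union> e ` T5)"
    and eT: "\<And>t. t \<in> T5 \<Longrightarrow> e t \<subseteq> t \<and> card (e t) = 2"
    using X unfolding S_graphs_def by blast
  have verts: "fst X = {..<15}" and cyc: "{k mod 15, Suc k mod 15} \<in> snd X" for k
    using e by (auto simp: G6_def cycle_graph_def mod_Suc_eq intro: exI[of _ "k mod 15"])
  obtain p :: "nat \<Rightarrow> real^3" and g where inj: "inj_on p (fst X)" and ptop: "p ` fst X \<subseteq> ?S"
    and g': "\<forall>d\<in>snd X. pathin (top_of_set ?S) (g d) \<and> inj_on (g d) {0..1} \<and>
          {g d 0, g d 1} = p ` d \<and> g d ` {0<..<1} \<inter> p ` fst X = {}"
    and gg': "\<forall>d\<in>snd X. \<forall>f\<in>snd X. d \<noteq> f \<longrightarrow> g d ` {0<..<1} \<inter> g f ` {0<..<1} = {}"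
    using \<open>embeds_in X (top_of_set ?S)\<close> unfolding embeds_in_def by auto
  note g = bspec[OF g'] and gg = gg'[rule_format]
  have ga: "arc (g d)" "path_image (g d) \<subseteq> ?S" if "d \<in> snd X" for d
    using g[OF that]
    by (auto simp: pathin_subtopology arc_def path_image_def path_def pathin_def)
  have orient: "\<exists>P. arc P \<and> pathstart P = p a \<and> pathfinish P = p b \<and>
      P ` {0<..<1} = g {a, b} ` {0<..<1} \<and> path_image P = path_image (g {a, b})"
    if "{a, b} \<in> snd X" for a b
    using arc_oriented[OF ga(1)[OF that], of "p a" "p b"] g[OF that] by (metis image_empty image_insert)
  have "\<exists>P. arc P \<and> pathstart P = p (k mod 15) \<and> pathfinish P = p (Suc k mod 15) \<and>
      P ` {0<..<1} = g {k mod 15, Suc k mod 15} ` {0<..<1} \<and>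
      path_image P = path_image (g {k mod 15, Suc k mod 15})" for k
    using orient[OF cyc] .
  then obtain G where G: "\<And>k. arc (G k)" "\<And>k. pathstart (G k) = p (k mod 15)"
      "\<And>k. pathfinish (G k) = p (Suc k mod 15)"
      "\<And>k. G k ` {0<..<1} = g {k mod 15, Suc k mod 15} ` {0<..<1}"
      "\<And>k. path_image (G k) = path_image (g {k mod 15, Suc k mod 15})"
    by metis
  define V where "V k = p (k mod 15)" for k
  have cyc_eq: "k mod 15 = l mod 15"
    if "{k mod 15, Suc k mod 15} = {l mod 15, Suc l mod (15::nat)}" for k l
    using that by (auto simp: doubleton_eq_iff mod_Suc split: if_splits)
  have openG: "G k ` {0<..<1} \<inter> p ` {..<15} = {}" for k
    using g[OF cyc[of k]] by (simp add: G(4) verts)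
  have imgG: "path_image (G k) = G k ` {0<..<1} \<union> {V k, V (Suc k)}" for k
    by (metis path_image_eq_open_arc G(2,3) V_def)
  have Vp: "V k \<in> p ` {..<15}" for k by (simp add: V_def)
  have VG: "V k \<notin> G l ` {0<..<1}" for k l using openG[of l] Vp[of k] by (meson disjoint_iff)
  interpret cycle_on_sphere 15 V G
  proof
    fix k l
    show "V k = V l \<longleftrightarrow> k mod 15 = l mod 15"
      using inj by (simp add: V_def verts inj_on_eq_iff)
    show "arc (G k)" "pathstart (G k) = V k" "pathfinish (G k) = V (Suc k)"
      using G by (simp_all add: V_def)
    show "path_image (G k) \<subseteq> ?S" using ga(2)[OF cyc] by (simp add: G(5))
    show "path_image (G (k mod 15)) = path_image (G k)" by (simp add: G(5) mod_Suc_eq)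
    assume "k mod 15 \<noteq> l mod 15"
    then have "{k mod 15, Suc k mod 15} \<noteq> {l mod 15, Suc l mod 15}" using cyc_eq by blast
    then have "G k ` {0<..<1} \<inter> G l ` {0<..<1} = {}"
      unfolding G(4) by (rule gg[OF cyc cyc])
    moreover have "G k ` {0<..<1} \<inter> {V l, V (Suc l)} = {}" "G l ` {0<..<1} \<inter> {V k, V (Suc k)} = {}"
      using VG by auto
    moreover have "(A \<union> D) \<inter> (B \<union> E) \<subseteq> D \<inter> E"
      if "A \<inter> B = {}" "A \<inter> E = {}" "B \<inter> D = {}" for A B D E :: "(real^3) set"
      using that by blast
    ultimately show "path_image (G k) \<inter> path_image (G l) \<subseteq> {V k, V (Suc k)} \<inter> {V l, V (Suc l)}"
      unfolding imgG by presburger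
  qed
  have "\<exists>x y. (x, y) \<in> {(i, 5 + i), (5 + i, 10 + i), (i, 10 + i)} \<and> e {va i, vb i, vc i} = {x, y}"
    if "i < 5" for i
  proof -
    let ?t = "{va i, vb i, vc i}"
    have "?t \<in> T5" using that unfolding T5_def by force
    then obtain x y where "e ?t = {x, y}" "x \<noteq> y" "x \<in> ?t" "y \<in> ?t"
      using eT[of ?t] by (auto simp: card_2_iff)
    then have "e ?t = {i, 5 + i} \<or> e ?t = {5 + i, 10 + i} \<or> e ?t = {i, 10 + i}"
      unfolding va_def vb_def vc_def by auto
    then show ?thesis by auto
  qed
  then obtain x y where xy: "\<And>i. i < 5 \<Longrightarrow> (x i, y i) \<in> {(i, 5 + i), (5 + i, 10 + i), (i, 10 + i)}"
    and exy: "\<And>i. i < 5 \<Longrightarrow> e {va i, vb i, vc i} = {x i, y i}"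
    by metis
  have chord: "{x i, y i} \<in> snd X" if "i < 5" for i
  proof -
    have "{va i, vb i, vc i} \<in> T5" using that unfolding T5_def by force
    then show ?thesis using exy[OF that] e by (metis UnI2 imageI snd_conv)
  qed
  have range: "x i < y i" "y i < 15" "x i mod 5 = i" "y i mod 5 = i" if "i < 5" for i
  proof -
    have "(5 + i) mod 5 = i" "(10 + i) mod 5 = i" using that by presburger+
    then show "x i < y i" "y i < 15" "x i mod 5 = i" "y i mod 5 = i" using xy[OF that] that by auto
  qed
  have "\<exists>P. arc P \<and> pathstart P = p (x i) \<and> pathfinish P = p (y i) \<and>
      P ` {0<..<1} = g {x i, y i} ` {0<..<1} \<and> path_image P = path_image (g {x i, y i})"
    if "i < 5" for i
    using orient[OF chord[OF that]] .
  then obtain P where P: "\<And>i. i < 5 \<Longrightarrow> arc (P i)" "\<And>i. i < 5 \<Longrightarrow> pathstart (P i) = p (x i)"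
      "\<And>i. i < 5 \<Longrightarrow> pathfinish (P i) = p (y i)"
      "\<And>i. i < 5 \<Longrightarrow> P i ` {0<..<1} = g {x i, y i} ` {0<..<1}"
      "\<And>i. i < 5 \<Longrightarrow> path_image (P i) = path_image (g {x i, y i})"
    by metis
  have PS: "path_image (P i) \<subseteq> ?S" if "i < 5" for i
    using ga(2)[OF chord[OF that]] P(5)[OF that] by simp
  have Pc: "P i ` {0<..<1} \<inter> curve = {}" if i: "i < 5" for i
  proof -
    have "P i ` {0<..<1} \<inter> path_image (G k) = {}" for k
    proof -
      \<comment> \<open>Both ends of chord \<open>i\<close> are congruent to \<open>i\<close> modulo
        5, while consecutive cycle vertices are incongruent, so a chord is never a cycle
        edge.\<close>
      have "{x i, y i} \<noteq> {k mod 15, Suc k mod 15}"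
      proof
        assume "{x i, y i} = {k mod 15, Suc k mod 15}"
        then have "k mod 15 mod 5 = Suc k mod 15 mod 5"
          using range(3,4)[OF i] unfolding doubleton_eq_iff by metis
        then have "k mod 5 = Suc k mod 5" by (simp add: mod_mod_cancel)
        then show False by presburger
      qed
      then have "P i ` {0<..<1} \<inter> G k ` {0<..<1} = {}"
        using gg[OF chord[OF i] cyc] P(4)[OF i] G(4) by simp
      moreover have "P i ` {0<..<1} \<inter> p ` {..<15} = {}"
        using g[OF chord[OF i]] unfolding P(4)[OF i] verts by (elim conjE)
      then have "V r \<notin> P i ` {0<..<1}" for r using Vp[of r] by (meson disjoint_iff)
      ultimately show ?thesis unfolding imgG by (simp add: Int_Un_distrib)
    qed
    then show ?thesis unfolding curve_def by blast
  qed
  have mid: "P i (1/2) \<in> P i ` {0<..<1}" for i by simp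
  have midS: "P i (1/2) \<in> ?S - curve" if "i < 5" for i
    using mid[of i] Pc[OF that] PS[OF that] path_image_eq_open_arc[of "P i"] by blast
  \<comment> \<open>Cutting at \<open>V 0\<close> and \<open>V 1\<close> presents the curve as two
    arcs, as the Jordan theorem requires; the midpoint of chord 0 is the point off the
    curve.\<close>
  obtain c1 c2 where c: "arc c1" "pathstart c1 = V 0" "pathfinish c1 = V 1"
    "arc c2" "pathstart c2 = V 0" "pathfinish c2 = V 1"
    "path_image c1 \<inter> path_image c2 = {V 0, V 1}" "curve = path_image c1 \<union> path_image c2"
    by (rule curve_split[of 0 1]) simp_all
  obtain A B where AB: "connected A" "connected B" "A \<union> B = ?S - curve"
    using Jordan_curve_sphere[OF c curve_sphere midS[of 0]] by (metis zero_less_numeral)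
  have "(P i (1/2) \<in> A) \<noteq> (P j (1/2) \<in> A)"
    if ij: "i < 5" "j < 5" "x i < x j" "x j < y i" "y i < y j" for i j
  proof
    assume eq: "(P i (1/2) \<in> A) = (P j (1/2) \<in> A)"
    have "i \<noteq> j" using ij by auto
    then have "{x i, y i} \<noteq> {x j, y j}" using range(3)[OF ij(1)] range(3,4)[OF ij(2)]
      by (metis doubleton_eq_iff)
    then have PQ: "P i ` {0<..<1} \<inter> P j ` {0<..<1} = {}"
      using gg[OF chord[OF ij(1)] chord[OF ij(2)]] P(4) ij by simp
    \<comment> \<open>\<open>T\<close> is \<open>A\<close> or \<open>B\<close>: by \<open>eq\<close>
      the midpoints are both in \<open>A\<close>, or neither is and both are in
      \<open>B\<close>.\<close>
    obtain T where T: "connected T" "T \<subseteq> ?S - curve" "P i (1/2) \<in> T" "P j (1/2) \<in> T"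
      using eq AB midS[OF ij(1)] midS[OF ij(2)] by blast
    have V: "V (x i) = p (x i)" "V (y i) = p (y i)" "V (x j) = p (x j)" "V (y j) = p (y j)"
      using range[OF ij(1)] range[OF ij(2)] by (simp_all add: V_def)
    have "T \<inter> P i ` {0<..<1} \<noteq> {}" "T \<inter> P j ` {0<..<1} \<noteq> {}" using T(3,4) mid by blast+
    with T(1,2) PQ show False
      using crossing_chords_separated[of "x i" "x j" "y i" "y j" "P i" "P j" T]
        ij range(2)[OF ij(2)] P(1-3) V PS Pc by simp
  qed
  then show False
    using chords_conflict_not_2_colourable[OF xy, of "\<lambda>i. P i (1/2) \<in> A"] by blast
qed

section \<open>The torus as a glued square\<close>

text \<open>Enumerating the edges allows the arcs to be given by formulas in the index rather than
  as functions of a two-element set.\<close>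

lemma embeds_in_indexed:
  assumes "snd G = E ` K" "inj_on E K" "inj_on p (fst G)" "p ` fst G \<subseteq> topspace Y"
    and "\<And>k. k \<in> K \<Longrightarrow> pathin Y (\<gamma> k)" "\<And>k. k \<in> K \<Longrightarrow> inj_on (\<gamma> k) {0..1}"
    and "\<And>k. k \<in> K \<Longrightarrow> {\<gamma> k 0, \<gamma> k 1} = p ` E k"
    and "\<And>k. k \<in> K \<Longrightarrow> \<gamma> k ` {0<..<1} \<inter> p ` fst G = {}"
    and "\<And>k l. k \<in> K \<Longrightarrow> l \<in> K \<Longrightarrow> k \<noteq> l \<Longrightarrow> \<gamma> k ` {0<..<1} \<inter> \<gamma> l ` {0<..<1} = {}"
  shows "embeds_in G Y"
  unfolding embeds_in_def
proof (rule exI[of _ p], rule exI[of _ "\<lambda>e. \<gamma> (inv_into K E e)"], intro conjI ballI impI)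
  fix e assume "e \<in> snd G"
  then obtain k where k: "k \<in> K" "e = E k" "inv_into K E e = k" using assms(1,2) by auto
  then show "pathin Y (\<gamma> (inv_into K E e))" "inj_on (\<gamma> (inv_into K E e)) {0..1}"
    "{\<gamma> (inv_into K E e) 0, \<gamma> (inv_into K E e) 1} = p ` e"
    "\<gamma> (inv_into K E e) ` {0<..<1} \<inter> p ` fst G = {}"
    using assms by simp_all
  fix f assume "f \<in> snd G" "e \<noteq> f"
  then obtain l where l: "l \<in> K" "f = E l" "inv_into K E f = l" using assms(1,2) by auto
  then show "\<gamma> (inv_into K E e) ` {0<..<1} \<inter> \<gamma> (inv_into K E f) ` {0<..<1} = {}"
    using k \<open>e \<noteq> f\<close> assms(9)[of k l] by auto
qed (use assms in auto)

lemma corner_1: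
  "corner (Suc 0) 0 = 1" "corner (Suc 0) (Suc 0) = \<i>" "corner (Suc 0) 2 = - 1"
  "corner (Suc 0) (Suc (Suc 0)) = - 1" "corner (Suc 0) 3 = - \<i>" "corner (Suc 0) 4 = 1"
proof -
  have "3 * pi / 2 = pi + pi / 2" by simp
  then have "cos (3 * pi / 2) = 0" "sin (3 * pi / 2) = - 1" by (simp_all only: cos_add sin_add) simp_all
  then show "corner (Suc 0) 3 = - \<i>"
    by (simp add: corner_def complex_eq_iff)
qed (simp_all add: corner_def complex_eq_iff)

text \<open>An affine map from the unit square to the diamond with corners 1, i, -1, -i. The sides
  \<open>s = 0\<close> and \<open>s = 1\<close> go to one glued pair, \<open>t = 0\<close> and
  \<open>t = 1\<close> to the other, so the torus becomes the usual quotient of the square.\<close>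

definition square_point :: "real \<Rightarrow> real \<Rightarrow> complex" where
  "square_point s t = Complex (s - t) (s + t - 1)"

lemma square_point_in_polygon:
  assumes "s \<in> {0..1}" "t \<in> {0..1}"
  shows "square_point s t \<in> polygon 1"
proof -
  have conv: "convex (polygon 1)" by (simp add: polygon_def convex_convex_hull)
  have cor: "corner 1 j \<in> polygon 1" if "j < 4" for j
    unfolding polygon_def using that by (intro hull_inc) auto
  have mem: "1 \<in> polygon 1" "\<i> \<in> polygon 1" "- 1 \<in> polygon 1" "- \<i> \<in> polygon 1"
    using cor[of 0] cor[of 1] cor[of 2] cor[of 3] by (simp_all add: corner_1)
  have comb: "(1 - u) *\<^sub>R a + u *\<^sub>R b \<in> polygon 1"
    if "a \<in> polygon 1" "b \<in> polygon 1" "u \<in> {0..1}" for a b u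
    using convexD_alt[OF conv that(1,2)] that(3) by auto
  have "(1 - t) *\<^sub>R ((1 - s) *\<^sub>R (- \<i>) + s *\<^sub>R 1) + t *\<^sub>R ((1 - s) *\<^sub>R (- 1) + s *\<^sub>R \<i>) \<in> polygon 1"
    by (intro comb mem assms)
  also have "(1 - t) *\<^sub>R ((1 - s) *\<^sub>R (- \<i>) + s *\<^sub>R 1) + t *\<^sub>R ((1 - s) *\<^sub>R (- 1) + s *\<^sub>R \<i>)
      = square_point s t"
    by (simp add: square_point_def complex_eq_iff algebra_simps)
  finally show ?thesis .
qed

definition torus_point :: "real \<Rightarrow> real \<Rightarrow> complex set" where
  "torus_point s t = {w. equivclp (side_glued 1) (square_point s t) w}"

text \<open>The two expressions are the square coordinates \<open>s\<close> and \<open>t\<close>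
  lowered by 1/2. Each gluing changes one of them by 1 and keeps the other, so their classes modulo
  the integers are invariant; this tells points of the torus apart.\<close>

lemma side_glued_1_lattice:
  assumes "equivclp (side_glued 1) z w"
  shows "(Re z + Im z) / 2 - (Re w + Im w) / 2 \<in> \<int> \<and> (Im z - Re z) / 2 - (Im w - Re w) / 2 \<in> \<int>"
proof -
  define f where "f z = (Re z + Im z) / 2" for z
  define h where "h z = (Im z - Re z) / 2" for z
  have glued: "f a - f b \<in> \<int> \<and> h a - h b \<in> \<int>" if "side_glued 1 a b" for a b
    using that
  proof cases
    case (1 m t)
    then have "f a - f b = 1" "h a - h b = 0"
      by (simp_all add: corner_1 linepath_def f_def h_def add_divide_distrib diff_divide_distrib)
    then show ?thesis by simp
  next
    case (2 m t)
    then have "f a - f b = 0" "h a - h b = 1"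
      by (simp_all add: corner_1 linepath_def f_def h_def add_divide_distrib diff_divide_distrib)
    then show ?thesis by simp
  qed
  have sym: "f b - f a \<in> \<int> \<and> h b - h a \<in> \<int>" if "f a - f b \<in> \<int> \<and> h a - h b \<in> \<int>" for a b
    using that Ints_minus[of "f a - f b"] Ints_minus[of "h a - h b"] by simp
  from assms have "f z - f w \<in> \<int> \<and> h z - h w \<in> \<int>"
  proof (induction rule: equivclp_induct)
    case (step w v)
    have "f w - f v \<in> \<int> \<and> h w - h v \<in> \<int>" using step.hyps glued sym by blast
    then have "(f z - f w) + (f w - f v) \<in> \<int>" "(h z - h w) + (h w - h v) \<in> \<int>"
      using step.IH by (blast intro: Ints_add)+
    then show ?case by simp
  qed simp
  then show ?thesis by (simp add: f_def h_def)
qed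

lemma torus_point_eqD:
  assumes "torus_point s t = torus_point s' t'"
  obtains a b :: int where "s - s' = of_int a" "t - t' = of_int b"
proof -
  have "square_point s' t' \<in> torus_point s t"
    unfolding assms by (simp add: torus_point_def)
  then have "equivclp (side_glued 1) (square_point s t) (square_point s' t')"
    by (simp add: torus_point_def)
  note L = side_glued_1_lattice[OF this]
  have st: "(Re (square_point u v) + Im (square_point u v)) / 2 = u - 1 / 2"
    "(Im (square_point u v) - Re (square_point u v)) / 2 = v - 1 / 2" for u v
    by (simp_all add: square_point_def field_simps)
  have "s - s' \<in> \<int>" "t - t' \<in> \<int>" using L unfolding st by simp_all
  then show ?thesis by (elim Ints_cases) (rule that)
qed

lemma equivclp_class_eq:
  "equivclp r z w \<Longrightarrow> {v. equivclp r z v} = {v. equivclp r w v}"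
  by (meson Collect_cong equivclp_sym equivclp_trans)

lemma torus_point_glue:
  "t \<in> {0..1} \<Longrightarrow> torus_point 1 t = torus_point 0 t"
  "s \<in> {0..1} \<Longrightarrow> torus_point s 1 = torus_point s 0"
proof -
  assume "t \<in> {0..1}"
  then have "side_glued 1 (square_point 1 t) (square_point 0 t)"
    using side_glued.intros(1)[of 0 1 t]
    by (simp add: corner_1 linepath_def square_point_def scaleR_conv_of_real complex_eq_iff
        Complex_eq algebra_simps)
  then show "torus_point 1 t = torus_point 0 t"
    unfolding torus_point_def by (intro equivclp_class_eq r_into_equivclp)
next
  assume "s \<in> {0..1}"
  \<comment> \<open>The second gluing runs from i to -1, against the direction of \<open>s\<close>,
    hence the parameter \<open>1 - s\<close>.\<close>
  then have "side_glued 1 (square_point s 1) (square_point s 0)"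
    using side_glued.intros(2)[of 0 1 "1 - s"]
    by (simp add: corner_1 linepath_def square_point_def scaleR_conv_of_real complex_eq_iff
        Complex_eq algebra_simps)
  then show "torus_point s 1 = torus_point s 0"
    unfolding torus_point_def by (intro equivclp_class_eq r_into_equivclp)
qed

lemma torus_point_in_topspace:
  "s \<in> {0..1} \<Longrightarrow> t \<in> {0..1} \<Longrightarrow> torus_point s t \<in> topspace (glued_polygon 1)"
  using square_point_in_polygon
  by (auto simp: glued_polygon_def topspace_quotient_topology torus_point_def)

lemma pathin_torus_point:
  assumes "continuous_on {0..1} s" "continuous_on {0..1} t"
    and "s ` {0..1} \<subseteq> {0..1}" "t ` {0..1} \<subseteq> {0..1}"
  shows "pathin (glued_polygon 1) (\<lambda>u. torus_point (s u) (t u))"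
proof -
  have "continuous_on {0..1} (\<lambda>u. square_point (s u) (t u))"
    unfolding square_point_def Complex_eq using assms(1,2) by (intro continuous_intros)
  moreover have "square_point (s u) (t u) \<in> polygon 1" if "u \<in> {0..1}" for u
    using assms(3,4) that by (intro square_point_in_polygon) blast+
  ultimately have "continuous_map (top_of_set {0..1}) (top_of_set (polygon 1))
      (\<lambda>u. square_point (s u) (t u))"
    by auto
  from continuous_map_compose[OF this quotient_imp_continuous_map[OF quotient_map_quotient_topology]]
  show ?thesis
    unfolding pathin_def glued_polygon_def torus_point_def by (simp add: comp_def)
qed

text \<open>After scaling by 5 and 15 the coordinates are determined modulo 5 and 15. A difference
  below 15 forces the second ones to agree and leaves a multiple of 5 in the first.\<close>

lemma torus_point_fifteenths_eqD:
  assumes "torus_point (a / 5) (b / 15) = torus_point (a' / 5) (b' / 15)" "\<bar>b - b'\<bar> < 15"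
  obtains m :: int where "a - a' = 5 * of_int m" "b = b'"
proof -
  obtain m n :: int where mn: "a / 5 - a' / 5 = of_int m" "b / 15 - b' / 15 = of_int n"
    using assms(1) by (rule torus_point_eqD)
  then have "\<bar>real_of_int n\<bar> < 1" using assms(2) by linarith
  then have "n = 0" by linarith
  then show ?thesis using that[of m] mn by simp
qed

section \<open>A drawing on the torus\<close>

text \<open>Indices below 15 enumerate the cycle edges; index \<open>15 + i\<close> stands for the
  chord from \<open>va i\<close> to \<open>vb i\<close>.\<close>

definition X6_edge :: "nat \<Rightarrow> nat set" where
  "X6_edge k = (if k < 15 then {k, Suc k mod 15} else {k - 15, k - 10})"

definition X6 :: "nat sgraph" where
  "X6 = ({..<15}, X6_edge ` {..<20})"

lemma X6_in_S_graphs: "X6 \<in> S_graphs G6 T5"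
proof -
  \<comment> \<open>The vertices below 10 are the \<open>va i\<close> and \<open>vb i\<close>, so
    the intersection drops \<open>vc i\<close> from each triple.\<close>
  let ?e = "\<lambda>t. t \<inter> {..<10::nat}"
  have T5: "T5 = (\<lambda>i. {i, 5 + i, 10 + i}) ` {..<5}"
    by (auto simp: T5_def va_def vb_def vc_def)
  have inter: "{i, 5 + i, 10 + i} \<inter> {..<10} = {i, 5 + i}" if "i < 5" for i :: nat
    using that by auto
  have "?e t \<subseteq> t \<and> card (?e t) = 2" if "t \<in> T5" for t
    using that inter unfolding T5 by auto
  moreover have "snd X6 = snd G6 \<union> ?e ` T5"
  proof -
    have "{..<20} = {..<15} \<union> (\<lambda>i. 15 + i) ` {..<5::nat}"
      unfolding lessThan_atLeast0 image_add_atLeastLessThan by auto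
    then have "snd X6 = X6_edge ` {..<15} \<union> X6_edge ` (\<lambda>i. 15 + i) ` {..<5}"
      by (simp only: X6_def snd_conv image_Un)
    moreover have "X6_edge ` {..<15} = snd G6"
      by (auto simp: G6_def cycle_graph_def X6_edge_def)
    moreover have "X6_edge ` (\<lambda>i. 15 + i) ` {..<5} = (\<lambda>i. {i, 5 + i}) ` {..<5}"
      unfolding image_image by (intro image_cong) (auto simp: X6_edge_def)
    moreover have "?e ` T5 = (\<lambda>i. {i, 5 + i}) ` {..<5}"
      unfolding T5 image_image using inter by (intro image_cong) auto
    ultimately show ?thesis by simp
  qed
  moreover have "fst X6 = fst G6" by (simp add: X6_def G6_def cycle_graph_def)
  ultimately show ?thesis
    unfolding S_graphs_def by (intro CollectI exI[of _ ?e]) (simp add: prod_eq_iff)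
qed

lemma X6_embeds_in_torus: "embeds_in X6 (glued_polygon 1)"
proof -
  define p where "p j = torus_point (real (j mod 5) / 5) (real j / 15)" for j
  \<comment> \<open>\<open>a\<close> and \<open>b\<close> are the coordinates scaled by 5 and 15: a
    cycle edge advances both by 1, chord \<open>i\<close> keeps \<open>a\<close> at \<open>i\<close>
    and raises \<open>b\<close> by 5. The residue \<open>k mod 5\<close> restarts each edge inside
    the square, so its first coordinate reaches 1 at most at its end.\<close>
  define a where "a k u = (if k < 15 then real (k mod 5) + u else real (k - 15))" for k u
  define b where "b k u = (if k < 15 then real k + u else real (k - 15) + 5 * u)" for k u
  define \<gamma> where "\<gamma> k u = torus_point (a k u / 5) (b k u / 15)" for k u
  \<comment> \<open>Several collisions below are refuted by showing that an interior parameter would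
    be an integer.\<close>
  have nonint: "u \<noteq> of_int z" if "u \<in> {0<..<1}" for u :: real and z
    using that by auto
  have mod5: "k mod 5 \<le> 4" for k :: nat by simp
  have ran: "a k u / 5 \<in> {0..1}" "b k u / 15 \<in> {0..1}" if "k < 20" "u \<in> {0..1}" for k u
    using that mod5[of k] by (auto simp: a_def b_def)
  have b_open: "0 < b k u" "b k u < 15" if "k < 20" "u \<in> {0<..<1}" for k u
    using that by (auto simp: b_def)
  show ?thesis
  proof (rule embeds_in_indexed[of X6 X6_edge "{..<20}" p "glued_polygon 1" \<gamma>])
    show "snd X6 = X6_edge ` {..<20}" by (simp add: X6_def)
    show "inj_on X6_edge {..<20}"
      by (auto simp: inj_on_def X6_edge_def doubleton_eq_iff mod_Suc split: if_splits)
    show "inj_on p (fst X6)"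
    proof (rule inj_onI)
      fix j l assume "j \<in> fst X6" "l \<in> fst X6" "p j = p l"
      then show "j = l" unfolding p_def
        by (elim torus_point_fifteenths_eqD) (auto simp: X6_def)
    qed
    show "p ` fst X6 \<subseteq> topspace (glued_polygon 1)"
    proof
      fix z assume "z \<in> p ` fst X6"
      then obtain j where "j < 15" "z = p j" by (auto simp: X6_def)
      then show "z \<in> topspace (glued_polygon 1)"
        unfolding p_def using mod5[of j] by (simp only:) (rule torus_point_in_topspace; auto)
    qed
  next
    fix k :: nat assume k: "k \<in> {..<20}"
    show "pathin (glued_polygon 1) (\<gamma> k)"
      unfolding \<gamma>_def
    proof (rule pathin_torus_point)
      show "continuous_on {0..1} (\<lambda>u. a k u / 5)" "continuous_on {0..1} (\<lambda>u. b k u / 15)"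
        unfolding a_def b_def by (cases "k < 15"; simp; intro continuous_intros)+
    qed (use ran k in blast)+
    show "inj_on (\<gamma> k) {0..1}"
    proof (rule inj_onI)
      fix u v :: real assume uv: "u \<in> {0..1}" "v \<in> {0..1}" "\<gamma> k u = \<gamma> k v"
      have "\<bar>b k u - b k v\<bar> < 15" using uv by (auto simp: b_def)
      then have "b k u = b k v"
        using uv(3) unfolding \<gamma>_def by (elim torus_point_fifteenths_eqD)
      then show "u = v" by (auto simp: b_def split: if_splits)
    qed
    show "{\<gamma> k 0, \<gamma> k 1} = p ` X6_edge k"
    proof (cases "k < 15")
      case True
      have "\<gamma> k 0 = p k" using True by (simp add: \<gamma>_def p_def a_def b_def)
      moreover have "\<gamma> k 1 = p (Suc k mod 15)"
      \<comment> \<open>An edge with \<open>k mod 5 = 4\<close> ends on the side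
        \<open>s = 1\<close>, glued to \<open>s = 0\<close>; for \<open>k = 14\<close> it ends at
        the corner \<open>(1, 1)\<close>, and the other gluing is applied too.\<close>
      proof (cases "k mod 5 = 4")
        case c: True
        then have s: "Suc k mod 5 = 0" by presburger
        have "\<gamma> k 1 = torus_point 1 (real (Suc k) / 15)"
          using True c by (simp add: \<gamma>_def a_def b_def add.commute)
        also have "\<dots> = torus_point 0 (real (Suc k) / 15)"
          using True by (intro torus_point_glue) auto
        also have "\<dots> = p (Suc k mod 15)"
        proof (cases "k = 14")
          case True
          then show ?thesis using torus_point_glue(2)[of 0] by (simp add: p_def)
        next
          case False
          then show ?thesis using \<open>k < 15\<close> s by (simp add: p_def mod_Suc)
        qed
        finally show ?thesis .
      next
        case False
        then have "Suc k mod 5 = Suc (k mod 5)" "k \<noteq> 14" by (auto simp: mod_Suc)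
        then show ?thesis using True
          by (simp add: \<gamma>_def p_def a_def b_def add.commute)
      qed
      ultimately show ?thesis using True by (simp add: X6_edge_def)
    next
      case False
      define i where "i = k - 15"
      have i: "i < 5" "k = 15 + i" using False k by (auto simp: i_def)
      have "(5 + i) mod 5 = i" using i(1) by simp
      then show ?thesis using i
        by (simp add: \<gamma>_def p_def a_def b_def X6_edge_def add.commute)
    qed
    show "\<gamma> k ` {0<..<1} \<inter> p ` fst X6 = {}"
    proof -
      have False if u: "u \<in> {0<..<1}" and l: "l < 15" and eq: "\<gamma> k u = p l" for u l
      proof -
        have "\<bar>b k u - real l\<bar> < 15" using b_open[OF _ u, of k] k l by auto
        then obtain m where m: "a k u - real (l mod 5) = 5 * of_int m" "b k u = real l"
          using eq unfolding \<gamma>_def p_def by (elim torus_point_fifteenths_eqD)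
        show False
        proof (cases "k < 15")
          case True
          then have "u = of_int (int l - int k)" using m by (simp add: b_def)
          then show False using nonint[OF u] by blast
        next
          case False
          define i where "i = k - 15"
          have "i < 5" using False k by (auto simp: i_def)
          \<comment> \<open>A vertex in the column of chord \<open>i\<close> has an index
            \<open>l\<close> congruent to \<open>i\<close> modulo 5, so equal heights
            \<open>l = i + 5 * u\<close> give \<open>u = l div 5\<close>.\<close>
          have "int i - int (l mod 5) = 5 * m"
            using m(1) False by (simp add: a_def i_def)
          then have "l mod 5 = i" using \<open>i < 5\<close> mod5[of l] by presburger
          then have "real l = 5 * real (l div 5) + real i"
            by (metis mult_div_mod_eq of_nat_add of_nat_mult of_nat_numeral)
          then have "u = of_int (int (l div 5))" using m(2) False by (simp add: b_def i_def)
          then show False using nonint[OF u] by blast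
        qed
      qed
      then show ?thesis unfolding X6_def fst_conv by blast
    qed
  next
    fix k l :: nat assume kl: "k \<in> {..<20}" "l \<in> {..<20}" "k \<noteq> l"
    have False if u: "u \<in> {0<..<1}" and v: "v \<in> {0<..<1}" and eq: "\<gamma> k u = \<gamma> l v" for u v
    proof -
      have "\<bar>b k u - b l v\<bar> < 15" using b_open[OF _ u, of k] b_open[OF _ v, of l] kl by auto
      then obtain m where m: "a k u - a l v = 5 * of_int m" "b k u = b l v"
        using eq unfolding \<gamma>_def by (elim torus_point_fifteenths_eqD)
      \<comment> \<open>Open cycle edges have heights in disjoint unit intervals; \<open>a\<close>
        is an integer on a chord but not on an open cycle edge; distinct chords stand in columns
        that differ modulo 5.\<close>
      consider "k < 15" "l < 15" | "k < 15" "15 \<le> l" | "15 \<le> k" "l < 15" | "15 \<le> k" "15 \<le> l"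
        by linarith
      then show False
      proof cases
        case 1
        then have "real k + u = real l + v" using m(2) by (simp add: b_def)
        moreover have "k < l \<or> l < k" using kl by linarith
        ultimately show False using u v by auto
      next
        case 2
        then have "u = of_int (5 * m + int (l - 15) - int (k mod 5))"
          using m(1) by (simp add: a_def)
        then show False using nonint[OF u] by blast
      next
        case 3
        then have "v = of_int (int (k - 15) - int (l mod 5) - 5 * m)"
          using m(1) by (simp add: a_def)
        then show False using nonint[OF v] by blast
      next
        case 4
        then have "int (k - 15) - int (l - 15) = 5 * m"
          using m(1) unfolding a_def by simp
        then show False using kl 4 unfolding lessThan_iff by presburger
      qed
    qed
    then show "\<gamma> k ` {0<..<1} \<inter> \<gamma> l ` {0<..<1} = {}" by blast
  qed
qed

section \<open>The minimum genus\<close>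

theorem theorem3p1:
  shows "genus_T T5 G6 = 1"
proof -
  have lower: "1 \<le> genus X" if "X \<in> S_graphs G6 T5" for X
    unfolding genus_def
  proof (rule INF_greatest)
    fix k assume "k \<in> {k. embeds_in_genus X k}"
    then have "k \<noteq> 0"
      using S_graphs_G6_T5_not_spherical[OF that] by (auto simp: embeds_in_genus_def split: if_splits)
    then show "1 \<le> enat k" by (simp add: one_enat_def)
  qed
  have "embeds_in_genus X6 1"
    using X6_embeds_in_torus by (simp add: embeds_in_genus_def)
  then have "genus X6 \<le> enat 1" unfolding genus_def by (intro INF_lower) simp
  then have X6: "genus X6 = 1" using lower[OF X6_in_S_graphs] by (simp add: one_enat_def)
  \<comment> \<open>\<open>Min\<close> calls for a finite set; the nonzero cardinality provides
    finiteness.\<close>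
  have "finite (S_graphs G6 T5)"
    using card_S_graphs_G6_T5 by (intro card_ge_0_finite) simp
  then show ?thesis
    unfolding genus_T_def
    using lower X6_in_S_graphs X6 by (intro Min_eqI) (auto intro: image_eqI[of _ _ X6])
qed

end
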